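(* Let $T$ be a tree with odd diameter. Then the eigenvalues of the eccentricity matrix $\mathcal{E}(T)$ are symmetric about the origin: if $\lambda$ is an eigenvalue of $\mathcal{E}(T)$ with multiplicity $k$, then $-\lambda$ is also an eigenvalue of $\mathcal{E}(T)$ with multiplicity $k$.
   Context: For a connected graph $G$ with distance function $d(u,v)$, the eccentricity of a vertex $u$ is $e(u)=\max_{v}d(u,v)$. The eccentricity matrix $\mathcal{E}(G)$ is the matrix indexed by $V(G)$ with $\mathcal{E}(G)_{uv}=d(u,v)$ if $d(u,v)=\min\{e(u),e(v)\}$, and $\mathcal{E}(G)_{uv}=0$ otherwise. The diameter is the largest distance between two vertices. *)

theory Defs
  imports
    "Graph_Theory.Graph_Theory"
    "Jordan_Normal_Form.Char_Poly"
begin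

text \<open>
  A finite simple undirected graph is a symmetric loop-free digraph without parallel arcs, that
  is, an instance of the locale \<^term>\<open>graph\<close>. The library predicates \<^term>\<open>forest\<close> and
  \<^term>\<open>tree\<close> are directed notions: in a symmetric digraph every edge, traversed back and
  forth, is a \<^term>\<open>pre_digraph.cycle\<close> of length 2. The cycles of the undirected graph are
  those of length at least 3. Connectedness includes that there is at least one vertex.
\<close>

definition undirected_tree :: "('a, 'b) pre_digraph \<Rightarrow> bool" where
  "undirected_tree G \<longleftrightarrow>
     graph G \<and> connected G \<and> \<not> (\<exists>p. pre_digraph.cycle G p \<and> length p \<ge> 3)"

context pre_digraph
begin

text \<open>Unspecified if there is no walk from \<open>u\<close> to \<open>v\<close>.\<close>

definition distance :: "'a \<Rightarrow> 'a \<Rightarrow> nat" where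
  "distance u v = (LEAST n. \<exists>p. awalk u p v \<and> length p = n)"

definition eccentricity :: "'a \<Rightarrow> nat" where
  "eccentricity u = Max {distance u v | v. v \<in> verts G}"

definition diameter :: nat where
  "diameter = Max {distance u v | u v. u \<in> verts G \<and> v \<in> verts G}"

definition ecc_entry :: "'a \<Rightarrow> 'a \<Rightarrow> nat" where
  "ecc_entry u v =
     (if distance u v = min (eccentricity u) (eccentricity v) then distance u v else 0)"

text \<open>
  Matrices are indexed by natural numbers, so a list \<open>vs\<close> enumerating the vertices without
  repetition fixes which row and column belongs to which vertex.
\<close>

definition ecc_matrix :: "'a list \<Rightarrow> real mat" where
  "ecc_matrix vs =
     Matrix.mat (length vs) (length vs) (\<lambda>(i, j). real (ecc_entry (vs ! i) (vs ! j)))"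

end

text \<open>The distance is the library's shortest-path cost for unit arc weights.\<close>

lemma (in wf_digraph) distance_eq_mu:
  assumes "u \<rightarrow>\<^sup>* v"
  shows "\<mu> (\<lambda>_. 1) u v = ereal (real (distance u v))"
proof -
  have cost: "awalk_cost (\<lambda>_. 1) p = real (length p)" for p :: "'b list"
    by (induction p) auto
  obtain p where p: "awalk u p v"
    using assms by (auto simp: reachable_awalk)
  have "\<exists>q. awalk u q v \<and> length q = distance u v"
    unfolding distance_def by (rule LeastI_ex) (use p in blast)
  then obtain q where q: "awalk u q v" "length q = distance u v"
    by blast
  have least: "distance u v \<le> length r" if "awalk u r v" for r
    unfolding distance_def by (rule Least_le) (use that in blast)
  show ?thesis
  proof (rule antisym)
    show "\<mu> (\<lambda>_. 1) u v \<le> ereal (real (distance u v))"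
      using min_cost_le_walk_cost[OF q(1), of "\<lambda>_. 1"] by (simp add: cost q(2))
    show "ereal (real (distance u v)) \<le> \<mu> (\<lambda>_. 1) u v"
      unfolding \<mu>_def by (rule INF_greatest) (auto simp: cost dest: least)
  qed
qed

end

theory Submission
  imports Defs
begin

text \<open>
  The distance of a tree satisfies Gromov's four-point condition with constant \<open>0\<close>. Let \<open>a\<close>
  and \<open>b\<close> realise the diameter \<open>D\<close>. As \<open>D\<close> is odd and trees are bipartite, no vertex is
  equally far from \<open>a\<close> and \<open>b\<close>. If \<open>u\<close> and \<open>v\<close> are both nearer to \<open>a\<close> than to \<open>b\<close>, the
  four-point condition \<open>d(u,v) + D \<le> max (d(u,a) + d(v,b)) (d(u,b) + d(v,a))\<close> forces \<open>d(u,v)\<close>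
  below \<open>d(u,b)\<close> and \<open>d(v,b)\<close>, hence below both eccentricities. So the eccentricity matrix
  vanishes within each of the two sides, and conjugation by a diagonal sign matrix maps it to
  its negative.
\<close>

section \<open>Distances in digraphs\<close>

context wf_digraph
begin

lemma distance_le: "awalk u p v \<Longrightarrow> distance u v \<le> length p"
  unfolding distance_def by (rule Least_le) blast

lemma shortest_awalk:
  assumes "u \<rightarrow>\<^sup>* v"
  obtains p where "awalk u p v" "length p = distance u v"
proof -
  obtain p where "awalk u p v"
    using assms by (auto simp: reachable_awalk)
  then have "\<exists>n p. awalk u p v \<and> length p = n"
    by blast
  then have "\<exists>p. awalk u p v \<and> length p = distance u v"
    unfolding distance_def by (rule LeastI_ex)
  then show ?thesis
    using that by blast
qed

lemma distance_self: "u \<in> verts G \<Longrightarrow> distance u u = 0"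
  using distance_le[of u "[]" u] by (simp add: awalk_Nil_iff)

lemma distance_eq_0D:
  assumes "u \<rightarrow>\<^sup>* v" "distance u v = 0"
  shows "u = v"
proof -
  obtain p where "awalk u p v" "length p = distance u v"
    using assms(1) by (rule shortest_awalk)
  then show ?thesis
    using assms(2) by (simp add: awalk_Nil_iff)
qed

lemma distance_triangle:
  assumes "u \<rightarrow>\<^sup>* v" "v \<rightarrow>\<^sup>* w"
  shows "distance u w \<le> distance u v + distance v w"
proof -
  obtain p where p: "awalk u p v" "length p = distance u v"
    using assms(1) by (rule shortest_awalk)
  obtain q where q: "awalk v q w" "length q = distance v w"
    using assms(2) by (rule shortest_awalk)
  have "awalk u (p @ q) w"
    using p(1) q(1) by (rule awalk_appendI)
  from distance_le[OF this] p(2) q(2) show ?thesis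
    by simp
qed

lemma distance_adjacent_le:
  assumes "u \<rightarrow> v"
  shows "distance u v \<le> 1"
proof -
  obtain e where "e \<in> arcs G" "tail G e = u" "head G e = v"
    using assms by (rule reachableE)
  then have "awalk u [e] v"
    using arc_implies_awalk by blast
  from distance_le[OF this] show ?thesis
    by simp
qed

text \<open>The rest of the walk from \<open>x\<close> on is shorter by at least the first arc.
  Hence a shortest walk never visits a vertex farther from its end than its start.\<close>

lemma distance_less_on_shortest_awalk:
  assumes p: "awalk u p v" "length p = distance u v"
    and x: "x \<in> set (awalk_verts u p)" "x \<noteq> u"
  shows "distance x v < distance u v"
proof (cases p)
  case Nil
  then show ?thesis
    using x by simp
next
  case (Cons e es)
  have es: "awalk (head G e) es v" and "x \<in> set (awalk_verts (head G e) es)"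
    using p(1) x Cons by (auto simp: awalk_Cons_iff)
  then obtain q r where "es = q @ r" "awalk x r v"
    using awalk_decomp by blast
  then show ?thesis
    using distance_le[of x r v] p(2) Cons by simp
qed

lemma adjacent_closer_exists:
  assumes "u \<rightarrow>\<^sup>* v" "u \<noteq> v"
  obtains x where "u \<rightarrow> x" "distance u v = Suc (distance x v)"
proof -
  obtain p where p: "awalk u p v" "length p = distance u v"
    using assms(1) by (rule shortest_awalk)
  then obtain e es where Cons: "p = e # es"
    using assms(2) by (cases p) (auto simp: awalk_Nil_iff)
  have e: "e \<in> arcs G" "tail G e = u" and es: "awalk (head G e) es v"
    using p(1) Cons by (auto simp: awalk_Cons_iff)
  have ux: "u \<rightarrow> head G e"
    using e by (auto simp: arcs_ends_conv)
  have "distance u v \<le> distance u (head G e) + distance (head G e) v"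
    using arc_implies_awalk[OF e(1)] e(2) es by (intro distance_triangle reachable_awalkI) simp_all
  moreover have "distance (head G e) v \<le> length es"
    using es by (rule distance_le)
  ultimately have "distance u v = Suc (distance (head G e) v)"
    using distance_adjacent_le[OF ux] p(2) Cons by simp
  with ux show ?thesis
    by (rule that)
qed

end

section \<open>Reversing walks\<close>

context sym_digraph
begin

lemma awalk_reverse:
  assumes "awalk u p v"
  obtains q where "awalk v q u" "length q = length p"
    "set (awalk_verts v q) = set (awalk_verts u p)"
proof -
  have "\<exists>q. awalk v q u \<and> length q = length p \<and> set (awalk_verts v q) = set (awalk_verts u p)"
    using assms
  proof (induction p arbitrary: u)
    case Nil
    then show ?case
      by (auto simp: awalk_Nil_iff intro!: exI[of _ "[]"])
  next
    case (Cons e es)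
    then have e: "e \<in> arcs G" "tail G e = u" and es: "awalk (head G e) es v"
      by (auto simp: awalk_Cons_iff)
    from Cons.IH[OF es] obtain q where q: "awalk v q (head G e)" "length q = length es"
      "set (awalk_verts v q) = set (awalk_verts (head G e) es)"
      by blast
    have "u \<rightarrow> head G e"
      using e by (auto simp: arcs_ends_conv)
    then have "head G e \<rightarrow> u"
      by (rule graph_symmetric)
    then obtain f where f: "f \<in> arcs G" "tail G f = head G e" "head G f = u"
      by blast
    have fw: "awalk (head G e) [f] u"
      using arc_implies_awalk[OF f(1)] f by simp
    have "awalk v (q @ [f]) u"
      using q(1) fw by (rule awalk_appendI)
    moreover have "head G e \<in> set (awalk_verts (head G e) es)"
      using es by (rule hd_in_awalk_verts)
    ultimately show ?case
      using q f e set_awalk_verts_append[OF q(1) fw]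
      by (intro exI[of _ "q @ [f]"]) auto
  qed
  then show ?thesis
    using that by blast
qed

lemma distance_commute: "distance u v = distance v u"
proof -
  \<comment> \<open>Walks in both directions realise the same lengths, so the two
    \<open>LEAST\<close> terms agree even if there is no walk at all.\<close>
  have "(\<exists>p. awalk u p v \<and> length p = n) \<longleftrightarrow> (\<exists>p. awalk v p u \<and> length p = n)" for n
    by (metis awalk_reverse)
  then show ?thesis
    unfolding distance_def by simp
qed

end

section \<open>Long cycles from walks that avoid a vertex\<close>

context loopfree_digraph
begin

text \<open>Shorten \<open>q\<close> to a path from \<open>y\<close> to \<open>z\<close> and close
  it up through \<open>x\<close>. As \<open>y\<close> and \<open>z\<close> differ, the path has an
  arc, so the cycle has at least three.\<close>

lemma cycle_through_vertex:
  assumes xy: "x \<rightarrow> y" and zx: "z \<rightarrow> x" and "y \<noteq> z"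
    and q: "awalk y q z" "x \<notin> set (awalk_verts y q)"
  shows "\<exists>p. cycle p \<and> 3 \<le> length p"
proof -
  define r where "r = awalk_to_apath q"
  have r: "apath y r z"
    unfolding r_def using q(1) by (rule apath_awalk_to_apath)
  then have rw: "awalk y r z" and dist: "distinct (awalk_verts y r)"
    by (auto simp: apath_def)
  have "r \<noteq> []"
    using rw \<open>y \<noteq> z\<close> by (auto simp: awalk_Nil_iff)
  moreover have sub: "set r \<subseteq> set q"
    unfolding r_def using q(1) by (rule awalk_to_apath_subset)
  ultimately have "q \<noteq> []"
    by auto
  \<comment> \<open>The vertices of a nonempty walk are the ends of its arcs, so the path, using
    only arcs of \<open>q\<close>, avoids \<open>x\<close> as well.\<close>
  have x: "x \<notin> set (awalk_verts y r)"
    using set_awalk_verts_not_Nil[OF rw \<open>r \<noteq> []\<close>] set_awalk_verts_not_Nil[OF q(1) \<open>q \<noteq> []\<close>]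
      sub q(2) by auto
  obtain e where e: "e \<in> arcs G" "tail G e = x" "head G e = y"
    using xy by blast
  obtain f where f: "f \<in> arcs G" "tail G f = z" "head G f = x"
    using zx by blast
  have fw: "awalk z [f] x"
    using arc_implies_awalk[OF f(1)] f by simp
  have w: "awalk y (r @ [f]) x"
    using rw fw by (rule awalk_appendI)
  have "awalk_verts y (r @ [f]) = awalk_verts y r @ [x]"
    using awalk_verts_append[OF w] rw f by simp
  then have "cycle (e # r @ [f])"
    unfolding cycle_def using w e x dist
    by (intro exI[of _ x]) (auto simp: awalk_Cons_iff)
  moreover have "3 \<le> length (e # r @ [f])"
    using \<open>r \<noteq> []\<close> by (cases r) auto
  ultimately show ?thesis
    by blast
qed

end


section \<open>The tree metric\<close>

locale undirected_tree_graph = graph +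
  assumes connected: "connected G"
    and no_long_cycle: "\<not> (\<exists>p. cycle p \<and> 3 \<le> length p)"
begin

lemma reachable: "u \<in> verts G \<Longrightarrow> v \<in> verts G \<Longrightarrow> u \<rightarrow>\<^sup>* v"
  using connected reachable_mk_symmetric_eq[OF sym_arcs]
  by (auto simp: connected_def strongly_connected_def)

lemma triangle:
  "u \<in> verts G \<Longrightarrow> v \<in> verts G \<Longrightarrow> w \<in> verts G \<Longrightarrow> distance u w \<le> distance u v + distance v w"
  by (rule distance_triangle[OF reachable reachable])

text \<open>Shortest walks from \<open>y\<close> and \<open>z\<close> to \<open>w\<close> avoid
  \<open>x\<close>; joined at \<open>w\<close> they would close a long cycle through
  \<open>x\<close>. The weak inequalities also cover ties, which yields bipartiteness next.\<close>

lemma closer_neighbour_unique: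
  assumes y: "x \<rightarrow> y" "distance y w \<le> distance x w"
    and z: "x \<rightarrow> z" "distance z w \<le> distance x w"
    and w: "w \<in> verts G"
  shows "y = z"
proof (rule ccontr)
  assume "y \<noteq> z"
  have walk: "\<exists>p. awalk v p w \<and> x \<notin> set (awalk_verts v p)"
    if v: "x \<rightarrow> v" "distance v w \<le> distance x w" for v
  proof -
    have "v \<in> verts G" "x \<noteq> v"
      using v(1) adj_not_same by auto
    then obtain p where "awalk v p w" "length p = distance v w"
      using shortest_awalk reachable w by blast
    then show ?thesis
      using distance_less_on_shortest_awalk[of v p w x] v(2) \<open>x \<noteq> v\<close> by auto
  qed
  obtain p where p: "awalk y p w" "x \<notin> set (awalk_verts y p)"
    using walk[OF y] by blast
  obtain q where q: "awalk z q w" "x \<notin> set (awalk_verts z q)"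
    using walk[OF z] by blast
  obtain r where r: "awalk w r z" "x \<notin> set (awalk_verts w r)"
    using q awalk_reverse[OF q(1)] by metis
  have "awalk y (p @ r) z"
    using p(1) r(1) by (rule awalk_appendI)
  moreover have "x \<notin> set (awalk_verts y (p @ r))"
    using set_awalk_verts_append[OF p(1) r(1)] p(2) r(2) by simp
  ultimately show False
    using cycle_through_vertex[OF y(1) graph_symmetric[OF z(1)] \<open>y \<noteq> z\<close>] no_long_cycle by blast
qed

text \<open>In a tie, \<open>y\<close> and the next vertex from \<open>x\<close> towards
  \<open>w\<close> would both be no farther from \<open>w\<close> than \<open>x\<close>, hence
  equal, although the latter is strictly closer.\<close>

lemma adjacent_distance_cases:
  assumes xy: "x \<rightarrow> y" and w: "w \<in> verts G"
  shows "distance x w = Suc (distance y w) \<or> distance y w = Suc (distance x w)"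
proof -
  have v: "x \<in> verts G" "y \<in> verts G"
    using xy by auto
  have yx: "y \<rightarrow> x"
    using xy by (rule graph_symmetric)
  have "distance x w \<le> Suc (distance y w)" "distance y w \<le> Suc (distance x w)"
    using triangle[OF v w] triangle[OF v(2,1) w] distance_adjacent_le[OF xy]
      distance_adjacent_le[OF yx] by linarith+
  moreover have "distance x w \<noteq> distance y w"
  proof
    assume eq: "distance x w = distance y w"
    show False
    proof (cases "x = w")
      case True
      then show False
        using eq distance_self[OF w] distance_eq_0D[OF reachable[OF v(2) w]] xy adj_not_same
        by auto
    next
      case False
      then obtain z where z: "x \<rightarrow> z" "distance x w = Suc (distance z w)"
        using adjacent_closer_exists reachable v(1) w by blast
      then have "y = z"
        using closer_neighbour_unique[OF xy _ z(1) _ w] eq by simp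
      then show False
        using z eq by simp
    qed
  qed
  ultimately show ?thesis
    by linarith
qed

text \<open>Bipartiteness in metric form: one step of \<open>u\<close> towards \<open>v\<close>
  changes both distances from \<open>u\<close> by exactly one, which preserves the parity of the
  sum.\<close>

lemma even_perimeter:
  assumes "u \<in> verts G" "v \<in> verts G" "w \<in> verts G"
  shows "even (distance u v + distance v w + distance w u)"
  using assms(1)
proof (induction "distance u v" arbitrary: u)
  case 0
  then have "u = v"
    using distance_eq_0D reachable assms by metis
  then show ?case
    using distance_commute[of v w] distance_self assms(2) by simp
next
  case (Suc n)
  then have "u \<noteq> v"
    using distance_self by auto
  then obtain x where x: "u \<rightarrow> x" "distance u v = Suc (distance x v)"
    using adjacent_closer_exists reachable Suc.prems assms by blast
  then have "even (distance x v + distance v w + distance w x)"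
    using Suc.hyps(1)[of x] Suc.hyps(2) x by auto
  moreover have "odd (distance w u + distance w x)"
    using adjacent_distance_cases[OF x(1) assms(3)] by (auto simp: distance_commute[of w])
  ultimately show ?case
    using x(2) by auto
qed

text \<open>Removing the edge \<open>xy\<close> separates the vertices nearer to \<open>x\<close> from those nearer to \<open>y\<close>.\<close>

lemma distance_across_edge:
  assumes "x \<rightarrow> y" and a: "a \<in> verts G" and v: "v \<in> verts G"
    and "distance y a = Suc (distance x a)" "distance x v = Suc (distance y v)"
  shows "distance a v = distance a x + distance x v"
  using assms(1,4,5)
proof (induction "distance y v" arbitrary: x y)
  case 0
  then have "y = v"
    using distance_eq_0D reachable v by (metis adj_in_verts(2))
  then show ?case
    using 0 distance_commute distance_self[OF v] by simp
next
  case (Suc n)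
  have y: "y \<in> verts G"
    using Suc.prems(1) by auto
  have "y \<noteq> v"
    using Suc.hyps(2) distance_self[OF v] by auto
  then obtain z where z: "y \<rightarrow> z" "distance y v = Suc (distance z v)"
    using adjacent_closer_exists reachable y v by blast
  have "x \<noteq> z"
    using z(2) Suc.prems(3) by auto
  \<comment> \<open>Only one neighbour of \<open>y\<close> is no farther from \<open>a\<close> than
    \<open>y\<close>, and that is \<open>x\<close>. So the step to \<open>z\<close> leads away from
    \<open>a\<close>, and the induction hypothesis applies to the edge \<open>yz\<close>.\<close>
  have "distance z a = Suc (distance y a)"
    using adjacent_distance_cases[OF z(1) a]
      closer_neighbour_unique[OF graph_symmetric[OF Suc.prems(1)] _ z(1) _ a] Suc.prems(2)
      \<open>x \<noteq> z\<close> by auto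
  then have "distance a v = distance a y + distance y v"
    using Suc.hyps z by auto
  then show ?case
    using Suc.prems by (simp add: distance_commute)
qed

text \<open>Move \<open>u\<close> one step towards \<open>v\<close>, to \<open>x\<close>. If this
  approaches both \<open>a\<close> and \<open>b\<close>, both sides of the inequality drop by one.
  Otherwise \<open>u\<close> lies between \<open>v\<close> and one of them, and the triangle
  inequality suffices.\<close>

lemma four_point_condition:
  assumes "u \<in> verts G" and v: "v \<in> verts G" and a: "a \<in> verts G" and b: "b \<in> verts G"
  shows "distance u v + distance a b
    \<le> max (distance u a + distance v b) (distance u b + distance v a)"
  using assms(1)
proof (induction "distance u v" arbitrary: u)
  case 0
  then have "u = v"
    using distance_eq_0D reachable v by metis
  then show ?case
    using triangle[OF a v b] distance_self[OF v] by (simp add: distance_commute)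
next
  case (Suc n)
  have u: "u \<in> verts G"
    by fact
  have "u \<noteq> v"
    using Suc distance_self by auto
  then obtain x where x: "u \<rightarrow> x" "distance u v = Suc (distance x v)"
    using adjacent_closer_exists reachable Suc.prems v by blast
  \<comment> \<open>If the step leads away from \<open>c\<close>, then
    \<open>d(c,v) = d(c,u) + d(u,v)\<close>; add
    \<open>d(c,d) \<le> d(c,u) + d(u,d)\<close>.\<close>
  have far: "distance u v + distance c d \<le> distance u d + distance v c"
    if "c \<in> verts G" "d \<in> verts G" "distance x c = Suc (distance u c)" for c d
    using distance_across_edge[OF x(1) that(1) v that(3) x(2)] triangle[OF that(1) u that(2)]
    by (simp add: distance_commute)
  consider "distance x a = Suc (distance u a)" | "distance x b = Suc (distance u b)"
    | "distance u a = Suc (distance x a)" "distance u b = Suc (distance x b)"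
    using adjacent_distance_cases[OF x(1)] a b by blast
  then show ?case
  proof cases
    case 1
    then show ?thesis
      using far[OF a b] by simp
  next
    case 2
    then show ?thesis
      using far[OF b a] by (simp add: distance_commute)
  next
    case 3
    have "distance x v + distance a b
        \<le> max (distance x a + distance v b) (distance x b + distance v a)"
      using Suc.hyps x by auto
    then show ?thesis
      using 3 x(2) by linarith
  qed
qed

section \<open>Eccentricities and the two ends of a diameter\<close>

lemma distance_le_eccentricity: "v \<in> verts G \<Longrightarrow> distance u v \<le> eccentricity u"
  unfolding eccentricity_def by (intro Max_ge) (auto simp: setcompr_eq_image)

lemma diameter_eq_Max_image:
  "diameter = Max ((\<lambda>(u, v). distance u v) ` (verts G \<times> verts G))"
  unfolding diameter_def by (rule arg_cong[where f = Max]) auto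

lemma distance_le_diameter: "u \<in> verts G \<Longrightarrow> v \<in> verts G \<Longrightarrow> distance u v \<le> diameter"
  unfolding diameter_eq_Max_image by (intro Max_ge) auto

lemma diameter_attained:
  obtains a b where "a \<in> verts G" "b \<in> verts G" "distance a b = diameter"
proof -
  have "verts G \<noteq> {}"
    using connected by (simp add: connected_def strongly_connected_def)
  then have "diameter \<in> (\<lambda>(u, v). distance u v) ` (verts G \<times> verts G)"
    unfolding diameter_eq_Max_image by (intro Max_in) auto
  then show ?thesis
    by (auto intro: that)
qed

lemma same_side_distance_less_eccentricity:
  assumes verts: "u \<in> verts G" "v \<in> verts G" "a \<in> verts G" "b \<in> verts G"
    and ab: "distance a b = diameter"
    and nearer: "distance u a < distance u b" "distance v a < distance v b"
  shows "distance u v < min (eccentricity u) (eccentricity v)"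
proof -
  have "distance u b \<le> diameter" "distance v b \<le> diameter"
    using verts by (simp_all add: distance_le_diameter)
  moreover have "distance u b \<le> eccentricity u" "distance v b \<le> eccentricity v"
    using verts by (simp_all add: distance_le_eccentricity)
  ultimately show ?thesis
    using four_point_condition[OF verts] ab nearer by linarith
qed

lemma ecc_entry_bipartite:
  assumes "odd diameter"
  obtains S where "\<And>u v. u \<in> verts G \<Longrightarrow> v \<in> verts G \<Longrightarrow> u \<in> S \<longleftrightarrow> v \<in> S \<Longrightarrow> ecc_entry u v = 0"
proof -
  obtain a b where ab: "a \<in> verts G" "b \<in> verts G" "distance a b = diameter"
    by (rule diameter_attained)
  \<comment> \<open>The triangle \<open>u\<close>, \<open>a\<close>, \<open>b\<close> has even
    perimeter and one odd side, so the other two sides differ in parity.\<close>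
  have neq: "distance u a \<noteq> distance u b" if "u \<in> verts G" for u
    using even_perimeter[OF that ab(1,2)] assms ab(3) by (auto simp: distance_commute[of b u])
  have "ecc_entry u v = 0"
    if uv: "u \<in> verts G" "v \<in> verts G"
      and side: "distance u a < distance u b \<longleftrightarrow> distance v a < distance v b" for u v
  proof (cases "distance u a < distance u b")
    case True
    with side have "distance u v < min (eccentricity u) (eccentricity v)"
      by (intro same_side_distance_less_eccentricity[OF uv ab]) auto
    then show ?thesis
      by (simp add: ecc_entry_def del: min_less_iff_conj)
  next
    \<comment> \<open>Without ties both vertices are nearer to \<open>b\<close>, and the ends of the
      diameter exchange roles.\<close>
    case False
    then have "distance u b < distance u a" "distance v b < distance v a"
      using side neq[OF uv(1)] neq[OF uv(2)] by auto
    moreover have "distance b a = diameter"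
      using ab(3) by (simp add: distance_commute)
    ultimately have "distance u v < min (eccentricity u) (eccentricity v)"
      using same_side_distance_less_eccentricity[OF uv ab(2,1)] by blast
    then show ?thesis
      by (simp add: ecc_entry_def del: min_less_iff_conj)
  qed
  then show ?thesis
    by (intro that[of "{w. distance w a < distance w b}"]) simp
qed

end


section \<open>Spectra of bipartite matrices\<close>

lemma pcompose_power:
  fixes p :: "'a :: comm_semiring_1 poly"
  shows "pcompose (p ^ n) q = pcompose p q ^ n"
  by (induction n) (simp_all add: pcompose_mult)

text \<open>Substituting \<open>-X\<close> turns a factor \<open>(X - a)^k\<close> into
  \<open>(X + a)^k\<close> up to sign, so the order at \<open>a\<close> is at most that at
  \<open>-a\<close>. Using this at \<open>x\<close> and at \<open>-x\<close> gives equality.\<close>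

lemma order_uminus_of_pcompose_uminus:
  fixes p :: "'a :: field poly"
  assumes p: "pcompose p [:0, -1:] = Polynomial.smult c p" and "c \<noteq> 0" "p \<noteq> 0"
  shows "Polynomial.order (- x) p = Polynomial.order x p"
proof -
  have le: "Polynomial.order a p \<le> Polynomial.order (- a) p" for a
  proof -
    let ?k = "Polynomial.order a p"
    obtain r where "p = [:- a, 1:] ^ ?k * r"
      using order_1[of a p] by (elim dvdE)
    then have "pcompose p [:0, -1:] = pcompose ([:- a, 1:] ^ ?k * r) [:0, -1:]"
      by (rule arg_cong)
    also have "\<dots> = (- [:a, 1:]) ^ ?k * pcompose r [:0, -1:]"
      by (simp add: pcompose_mult pcompose_power pcompose_pCons)
    also have "\<dots> = [:a, 1:] ^ ?k * ((- 1) ^ ?k * pcompose r [:0, -1:])"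
      by (subst power_minus) simp
    finally have "[:a, 1:] ^ ?k dvd Polynomial.smult c p"
      using p by simp
    then have "[:- (- a), 1:] ^ ?k dvd p"
      using \<open>c \<noteq> 0\<close> by (simp add: dvd_smult_iff)
    then show ?thesis
      unfolding order_divides using \<open>p \<noteq> 0\<close> by simp
  qed
  show ?thesis
    using le[of x] le[of "- x"] by simp
qed

text \<open>At each \<open>x\<close>, \<open>det (xI + A) = (-1)^n det (-xI - A)\<close>. In
  characteristic zero, polynomials with equal values everywhere are equal.\<close>

lemma char_poly_uminus:
  fixes A :: "'a :: {field, ring_char_0} mat"
  assumes A: "A \<in> carrier_mat n n"
  shows "char_poly (- A) = Polynomial.smult ((- 1) ^ n) (pcompose (char_poly A) [:0, -1:])"
proof -
  have "poly (char_poly (- A)) x = (- 1) ^ n * poly (char_poly A) (- x)" for x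
  proof -
    have "- char_matrix (- A) x = (- 1) \<cdot>\<^sub>m (- char_matrix A (- x))"
      using A by (intro eq_matI) (auto simp: char_matrix_def)
    moreover have "- A \<in> carrier_mat n n"
      using A by simp
    moreover have "dim_col (- char_matrix A (- x)) = n"
      using A by (simp add: char_matrix_def)
    ultimately show ?thesis
      using A by (simp add: char_poly_matrix)
  qed
  then show ?thesis
    by (intro poly_eq_poly_eq_iff[THEN iffD1] ext) (simp add: poly_pcompose)
qed

text \<open>Conjugation by the involution \<open>D = diag(s)\<close> multiplies entry
  \<open>(i, j)\<close> by \<open>s i * s j\<close>, which is \<open>-1\<close> across the two
  classes; within a class the entry is zero.\<close>

lemma similar_mat_uminus_of_bipartite:
  fixes A :: "'a :: comm_ring_1 mat"
  assumes A: "A \<in> carrier_mat n n"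
    and bip: "\<And>i j. i < n \<Longrightarrow> j < n \<Longrightarrow> P i \<longleftrightarrow> P j \<Longrightarrow> A $$ (i, j) = 0"
  shows "similar_mat (- A) A"
proof -
  define s :: "nat \<Rightarrow> 'a" where "s i = (if P i then 1 else - 1)" for i
  define D where "D = mat n n (\<lambda>(i, j). if i = j then s i else 0)"
  have D: "D \<in> carrier_mat n n"
    by (simp add: D_def)
  have left: "D * B = mat n n (\<lambda>(i, j). s i * B $$ (i, j))" if "B \<in> carrier_mat n n" for B
    using that by (intro eq_matI)
      (auto simp: D_def scalar_prod_def if_distrib[of "\<lambda>x. x * _"] sum.delta cong: if_cong)
  have right: "B * D = mat n n (\<lambda>(i, j). B $$ (i, j) * s j)" if "B \<in> carrier_mat n n" for B
    using that by (intro eq_matI)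
      (auto simp: D_def scalar_prod_def if_distrib[of "\<lambda>x. _ * x"] sum.delta cong: if_cong)
  have DD: "D * D = 1\<^sub>m n"
    unfolding left[OF D] by (intro eq_matI) (auto simp: D_def s_def)
  have "D * A * D = - A"
    unfolding left[OF A] by (subst right) (use A bip in \<open>auto intro!: eq_matI simp: s_def\<close>)
  then show ?thesis
    using A D DD by (intro similar_matI[of _ _ D D n]) auto
qed

lemma order_char_poly_uminus_of_bipartite:
  fixes A :: "'a :: {field, ring_char_0} mat"
  assumes A: "A \<in> carrier_mat n n"
    and bip: "\<And>i j. i < n \<Longrightarrow> j < n \<Longrightarrow> P i \<longleftrightarrow> P j \<Longrightarrow> A $$ (i, j) = 0"
  shows "Polynomial.order (- x) (char_poly A) = Polynomial.order x (char_poly A)"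
proof (rule order_uminus_of_pcompose_uminus)
  have "char_poly A = char_poly (- A)"
    using char_poly_similar[OF similar_mat_uminus_of_bipartite[OF A bip]] by simp
  also have "\<dots> = Polynomial.smult ((- 1) ^ n) (pcompose (char_poly A) [:0, -1:])"
    by (rule char_poly_uminus[OF A])
  \<comment> \<open>The sign \<open>(-1)^n\<close> is its own inverse, so multiplying by it moves it
    to the other side.\<close>
  finally have "Polynomial.smult ((- 1) ^ n) (char_poly A)
      = Polynomial.smult ((- 1) ^ n) (Polynomial.smult ((- 1) ^ n) (pcompose (char_poly A) [:0, -1:]))"
    by simp
  then show "pcompose (char_poly A) [:0, -1:] = Polynomial.smult ((- 1) ^ n) (char_poly A)"
    by (simp flip: power_mult_distrib)
  show "char_poly A \<noteq> 0"
    using degree_monic_char_poly[OF A] by auto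
qed simp

lemma eigenvalue_iff_order_char_poly:
  fixes A :: "'a :: field mat"
  assumes A: "A \<in> carrier_mat n n"
  shows "eigenvalue A x \<longleftrightarrow> Polynomial.order x (char_poly A) \<noteq> 0"
  using eigenvalue_root_char_poly[OF A] degree_monic_char_poly[OF A] by (auto simp: order_root)

text \<open>Multiplicity is the order of the root of the characteristic polynomial; the matrix being
  real symmetric, this is also the dimension of the eigenspace.\<close>

theorem theorem4p1:
  fixes T :: "('a, 'b) pre_digraph"
    and vs :: "'a list"
    and \<theta> :: real
    and k :: nat
  assumes "undirected_tree T"
    and "odd (pre_digraph.diameter T)"
    and "distinct vs"
    and "set vs = verts T"
    and "eigenvalue (pre_digraph.ecc_matrix T vs) \<theta>"
    and "Polynomial.order \<theta> (char_poly (pre_digraph.ecc_matrix T vs)) = k"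
  shows "eigenvalue (pre_digraph.ecc_matrix T vs) (- \<theta>)
    \<and> Polynomial.order (- \<theta>) (char_poly (pre_digraph.ecc_matrix T vs)) = k"
proof -
  interpret graph T
    using assms(1) by (simp add: undirected_tree_def)
  interpret undirected_tree_graph T
    using assms(1) by unfold_locales (auto simp: undirected_tree_def)
  let ?A = "ecc_matrix vs"
  have A: "?A \<in> carrier_mat (length vs) (length vs)"
    by (simp add: ecc_matrix_def)
  obtain S where S: "\<And>u v. u \<in> verts T \<Longrightarrow> v \<in> verts T \<Longrightarrow> u \<in> S \<longleftrightarrow> v \<in> S \<Longrightarrow> ecc_entry u v = 0"
    using ecc_entry_bipartite[OF assms(2)] by blast
  \<comment> \<open>The classes of vertices are transported to indices along the enumeration
    \<open>vs\<close>.\<close>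
  have "?A $$ (i, j) = 0" if "i < length vs" "j < length vs" "vs ! i \<in> S \<longleftrightarrow> vs ! j \<in> S" for i j
    using that S[of "vs ! i" "vs ! j"] nth_mem[of _ vs] assms(4) by (simp add: ecc_matrix_def)
  then have "Polynomial.order (- \<theta>) (char_poly ?A) = Polynomial.order \<theta> (char_poly ?A)"
    by (rule order_char_poly_uminus_of_bipartite[OF A])
  then show ?thesis
    using assms(5,6) by (simp add: eigenvalue_iff_order_char_poly[OF A])
qed

end
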